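(* Let $\chi > 1$ be a real number and let $m \ge 1$ be an integer. Then $$\mathcal{T}_{m+1}(\chi) = 2\chi\,\mathcal{T}_m(\chi) - \mathcal{T}_{m-1}(\chi).$$
   Context: For an integer $m \ge 0$ and real $\chi > 1$, define $$\mathcal{T}_m(\chi) = \int_0^{2\pi} \frac{\cos m\varphi}{\chi-\cos\varphi}\, d\varphi .$$ *)

theory Defs
  imports "HOL-Analysis.Analysis"
begin

definition calT :: "nat \<Rightarrow> real \<Rightarrow> real" where
  "calT m chi = integral {0..2 * pi} (\<lambda>\<phi>. cos (real m * \<phi>) / (chi - cos \<phi>))"

end

theory Submission
  imports Defs
begin

text \<open>
  The recurrence comes from the identity
  \<open>cos ((m + 1) \<phi>) + cos ((m - 1) \<phi>) = 2 cos \<phi> cos (m \<phi>)\<close>.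
  Writing \<open>cos \<phi> = chi - (chi - cos \<phi>)\<close> on the right and dividing by \<open>chi - cos \<phi>\<close>,
  which is positive because \<open>chi > 1\<close>, turns it into a relation between the three
  integrands whose only remainder is \<open>- 2 cos (m \<phi>)\<close>. That remainder integrates to zero
  over a full period as \<open>m \<ge> 1\<close> (lemma \<open>has_integral_cos_period\<close>), and continuity of
  the integrands (lemma \<open>calT_has_integral\<close>) allows integrating term by term.
\<close>

lemma has_integral_cos_period:
  fixes m :: nat
  assumes "m \<ge> 1"
  shows "((\<lambda>x. cos (real m * x)) has_integral 0) {0..2 * pi}"
proof -
  have "((\<lambda>x. cos (real m * x)) has_integral
      sin (real m * (2 * pi)) / real m - sin (real m * 0) / real m) {0..2 * pi}"
  proof (rule fundamental_theorem_of_calculus)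
    fix x :: real
    have "((\<lambda>x. sin (real m * x) / real m) has_real_derivative cos (real m * x))
        (at x within {0..2 * pi})"
      using assms by (auto intro!: derivative_eq_intros)
    then show "((\<lambda>x. sin (real m * x) / real m) has_vector_derivative cos (real m * x))
        (at x within {0..2 * pi})"
      by (simp add: has_real_derivative_iff_has_vector_derivative)
  qed simp
  moreover have "sin (real m * (2 * pi)) = 0"
    using sin_npi[of "2 * m"] by (simp add: mult_ac)
  ultimately show ?thesis by simp
qed

lemma calT_has_integral:
  assumes "chi > 1"
  shows "((\<lambda>x. cos (real m * x) / (chi - cos x)) has_integral calT m chi) {0..2 * pi}"
proof -
  have "chi - cos x \<noteq> 0" for x
    using cos_le_one[of x] assms by linarith
  then have "continuous_on {0..2 * pi} (\<lambda>x. cos (real m * x) / (chi - cos x))"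
    by (intro continuous_intros) auto
  then show ?thesis
    unfolding calT_def by (intro integrable_integral integrable_continuous_real)
qed

theorem lemmaA3:
  fixes chi :: real and m :: nat
  assumes "chi > 1" and "m \<ge> 1"
  shows "calT (m + 1) chi = 2 * chi * calT m chi - calT (m - 1) chi"
proof -
  have integrand: "cos (real (m + 1) * x) / (chi - cos x) =
      2 * chi * (cos (real m * x) / (chi - cos x)) - cos (real (m - 1) * x) / (chi - cos x)
      - 2 * cos (real m * x)" for x
  proof -
    have pos: "chi - cos x \<noteq> 0"
      using cos_le_one[of x] assms by linarith
    have "cos (real (m + 1) * x) = cos (real m * x + x)"
      by (simp add: algebra_simps)
    moreover have "cos (real (m - 1) * x) = cos (real m * x - x)"
      using assms by (simp add: of_nat_diff algebra_simps)
    ultimately have "cos (real (m + 1) * x) =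
        2 * chi * cos (real m * x) - cos (real (m - 1) * x)
        - 2 * cos (real m * x) * (chi - cos x)"
      by (simp add: cos_add cos_diff algebra_simps)
    then show ?thesis
      using pos by (simp add: diff_divide_distrib)
  qed
  have "((\<lambda>x. 2 * chi * (cos (real m * x) / (chi - cos x))
      - cos (real (m - 1) * x) / (chi - cos x) - 2 * cos (real m * x)) has_integral
      2 * chi * calT m chi - calT (m - 1) chi - 2 * 0) {0..2 * pi}"
    by (intro has_integral_diff has_integral_mult_right calT_has_integral
        has_integral_cos_period assms)
  then have "((\<lambda>x. cos (real (m + 1) * x) / (chi - cos x)) has_integral
      2 * chi * calT m chi - calT (m - 1) chi) {0..2 * pi}"
    by (simp only: integrand mult_zero_right diff_zero)
  with calT_has_integral[OF assms(1), of "m + 1"] show ?thesis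
    by (rule has_integral_unique)
qed

end
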